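(* Any two demicaps in $AG(4,3)$ are affinely equivalent: if $D_1,D_2$ are demicaps, there is an affine transformation $v\mapsto Av+b$ with $A\in GL(4,3)$, $b\in\mathbb{F}_3^4$, mapping $D_1$ onto $D_2$.
   Context: $AG(4,3)$ is the affine space $\mathbb{F}_3^4$; a line is a set of three distinct points $\{x,y,z\}$ with $x+y+z=0$. A cap is a set of points containing no line. A hyperplane is a $3$-dimensional affine subspace of $\mathbb{F}_3^4$; a set of points is co-hyperplanar if it lies in a common hyperplane. For a point $a$, an $a$-line is a pair of points $\{b,c\}$ such that $\{a,b,c\}$ is a line. A demicap with anchor point $a$ is a cap consisting of the $10$ points of five $a$-lines such that no four of these five $a$-lines are co-hyperplanar. *)

theory Defs
  imports "HOL-Analysis.Analysis" "HOL-Library.Numeral_Type"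
begin

text \<open>Points of AG(4,3) are vectors in F_3^4, modelled as the type 3^4
  (type 3 is the integers mod 3, a commutative ring, here the field F_3).\<close>

type_synonym pt = "3 ^ 4"

definition is_line :: "pt set \<Rightarrow> bool" where
  "is_line S \<longleftrightarrow> (\<exists>x y z. S = {x, y, z} \<and> x \<noteq> y \<and> x \<noteq> z \<and> y \<noteq> z \<and> x + y + z = 0)"

definition is_cap :: "pt set \<Rightarrow> bool" where
  "is_cap C \<longleftrightarrow> (\<forall>S. S \<subseteq> C \<longrightarrow> \<not> is_line S)"

text \<open>Linear subspace of F_3^4 (over F_3).\<close>
definition is_subspace3 :: "pt set \<Rightarrow> bool" where
  "is_subspace3 V \<longleftrightarrow> 0 \<in> V \<and> (\<forall>x\<in>V. \<forall>y\<in>V. x + y \<in> V)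
     \<and> (\<forall>c::3. \<forall>x\<in>V. c *s x \<in> V)"

text \<open>Hyperplane: a 3-dimensional affine subspace, i.e. a translate of a linear
  subspace of dimension 3 (equivalently of cardinality 3^3 over F_3).\<close>
definition is_hyperplane :: "pt set \<Rightarrow> bool" where
  "is_hyperplane H \<longleftrightarrow> (\<exists>b V. is_subspace3 V \<and> card V = 3 ^ 3 \<and> H = (\<lambda>v. b + v) ` V)"

definition cohyperplanar :: "pt set \<Rightarrow> bool" where
  "cohyperplanar S \<longleftrightarrow> (\<exists>H. is_hyperplane H \<and> S \<subseteq> H)"

definition is_a_line :: "pt \<Rightarrow> pt set \<Rightarrow> bool" where
  "is_a_line a P \<longleftrightarrow> (\<exists>b c. P = {b, c} \<and> b \<noteq> c \<and> is_line {a, b, c})"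

definition is_demicap_anchor :: "pt \<Rightarrow> pt set \<Rightarrow> bool" where
  "is_demicap_anchor a D \<longleftrightarrow> is_cap D \<and>
     (\<exists>L. card L = 5 \<and> (\<forall>P\<in>L. is_a_line a P) \<and> D = \<Union>L \<and> card D = 10 \<and>
          (\<forall>L'. L' \<subseteq> L \<and> card L' = 4 \<longrightarrow> \<not> cohyperplanar (\<Union>L')))"

definition is_demicap :: "pt set \<Rightarrow> bool" where
  "is_demicap D \<longleftrightarrow> (\<exists>a. is_demicap_anchor a D)"

end

theory Submission
  imports Defs
begin

text \<open>A demicap with anchor \<open>a\<close> is the union of the pairs \<open>{a + v, a - v}\<close> over five
  directions \<open>v\<close>. If a nonzero functional \<open>y\<close> vanished on four of the directions, the four
  \<open>a\<close>-lines would lie in the hyperplane \<open>a + ker y\<close>. Since three vectors of \<open>F_3^4\<close> always have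
  a common annihilator, four directions \<open>u_1, ..., u_4\<close> therefore form a basis, and the fifth is
  \<open>u_0 = \<Sum> w_j u_j\<close> with every \<open>w_j\<close> nonzero (a vanishing \<open>w_j\<close> would put \<open>u_0\<close> and three
  others into one kernel). Over \<open>F_3\<close> this means \<open>w_j = \<plusminus>1\<close>, so the invertible linear map
  \<open>e_j \<mapsto> w_j u_j\<close> sends \<open>(1,1,1,1)\<close> to \<open>u_0\<close> and each pair \<open>{\<plusminus>e_j}\<close> onto \<open>{\<plusminus>u_j}\<close>. Hence
  every demicap is an affine image of \<open>{\<plusminus>e_1, ..., \<plusminus>e_4, \<plusminus>(1,1,1,1)}\<close>.\<close>

lemma num3_cases: "(x::3) = 0 \<or> x = 1 \<or> x = -1"
proof (induct x)
  case (of_int z)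
  then have "z = 0 \<or> z = 1 \<or> z = 2" by fastforce
  then show ?case by auto
qed

lemma num3_square_nonzero: "(c::3) \<noteq> 0 \<Longrightarrow> c * c = 1"
  using num3_cases[of c] by auto

lemma num3_mult_eq_0_iff: "(c::3) * d = 0 \<longleftrightarrow> c = 0 \<or> d = 0"
proof
  assume "c * d = 0"
  moreover have "d = c * (c * d)" if "c \<noteq> 0"
    using num3_square_nonzero[OF that] by (simp add: mult.assoc[symmetric])
  ultimately show "c = 0 \<or> d = 0"
    by auto
qed auto

lemma vec3_add_self_twice: "(v::3^'n) + v + v = 0"
proof -
  have "x + x + x = 0" for x :: 3
    using num3_cases[of x] by auto
  then show ?thesis by (simp add: vec_eq_iff)
qed

lemma pair_smult_num3:
  fixes v :: "3^'n"
  assumes "c \<noteq> 0"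
  shows "{a + c *s v, a - c *s v} = {a + v, a - v}"
  using num3_cases[of c] assms by (auto simp: vector_smult_lneg)

definition dot :: "'a::comm_ring_1^'n \<Rightarrow> 'a^'n \<Rightarrow> 'a" where
  "dot y v = (\<Sum>i\<in>UNIV. y $ i * v $ i)"

lemma dot_zero_right [simp]: "dot y 0 = 0"
  by (simp add: dot_def)

lemma dot_add_right: "dot y (u + v) = dot y u + dot y v"
  by (simp add: dot_def sum.distrib distrib_left)

lemma dot_diff_right: "dot y (u - v) = dot y u - dot y v"
  by (simp add: dot_def sum_subtractf right_diff_distrib)

lemma dot_minus_right: "dot y (- v) = - dot y v"
  by (simp add: dot_def sum_negf)

lemma dot_smult_right: "dot y (c *s v) = c * dot y v"
  by (simp add: dot_def sum_distrib_left mult_ac)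

lemma dot_sum_right: "dot y (\<Sum>j\<in>J. f j) = (\<Sum>j\<in>J. dot y (f j))"
  by (induct J rule: infinite_finite_induct) (simp_all add: dot_add_right)

lemma dot_diff_left: "dot (y - y') v = dot y v - dot y' v"
  by (simp add: dot_def sum_subtractf left_diff_distrib)

lemma dot_axis_right: "dot y (axis k 1) = y $ k"
  by (simp add: dot_def axis_def if_distrib cong: if_cong)

definition has_annihilator :: "('a::comm_ring_1^'n) set \<Rightarrow> bool" where
  "has_annihilator S \<longleftrightarrow> (\<exists>y. y \<noteq> 0 \<and> (\<forall>v\<in>S. dot y v = 0))"

lemma has_annihilator_if_card_less:
  fixes S :: "('a::{comm_ring_1,finite}^'n) set"
  assumes "card S < CARD('n)"
  shows "has_annihilator S"
proof -
  define f where "f y = restrict (dot y) S" for y :: "'a^'n"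
  have "1 < CARD('a)"
    using card_mono[of "UNIV::'a set" "{0, 1}"] by simp
  then have "card (S \<rightarrow>\<^sub>E (UNIV::'a set)) < CARD('a^'n)"
    using assms by (simp add: card_funcsetE power_strict_increasing)
  moreover have "range f \<subseteq> S \<rightarrow>\<^sub>E UNIV"
    by (auto simp: f_def)
  ultimately have "\<not> inj f"
    using card_inj_on_le[of f UNIV "S \<rightarrow>\<^sub>E UNIV"] by (auto simp: finite_PiE)
  then obtain y y' where "y \<noteq> y'" "f y = f y'"
    by (auto simp: inj_def)
  then have "dot y v = dot y' v" if "v \<in> S" for v
    using that unfolding f_def by (metis restrict_apply')
  then show ?thesis
    unfolding has_annihilator_def using \<open>y \<noteq> y'\<close>
    by (intro exI[of _ "y - y'"]) (simp add: dot_diff_left)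
qed

lemma card_dot_kernel:
  fixes y :: "3^'n"
  assumes "y \<noteq> 0"
  shows "card {x. dot y x = 0} * 3 = CARD(3^'n)"
proof -
  obtain k where "y $ k \<noteq> 0"
    using assms by (auto simp: vec_eq_iff)
  define e where "e = y $ k *s axis k 1"
  have e: "dot y e = 1"
    using \<open>y $ k \<noteq> 0\<close> by (simp add: e_def dot_smult_right dot_axis_right num3_square_nonzero)
  have "bij_betw (\<lambda>(x, t). x + t *s e) ({x. dot y x = 0} \<times> UNIV) UNIV"
    by (rule bij_betw_byWitness[where f' = "\<lambda>z. (z - dot y z *s e, dot y z)"])
      (auto simp: dot_add_right dot_smult_right dot_diff_right e)
  then have "card ({x. dot y x = 0} \<times> (UNIV::3 set)) = CARD(3^'n)"
    by (rule bij_betw_same_card)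
  then show ?thesis
    by (simp add: card_cartesian_product)
qed

lemma hyperplane_dot_kernel:
  fixes y :: pt
  assumes "y \<noteq> 0"
  shows "is_hyperplane ((\<lambda>v. a + v) ` {x. dot y x = 0})"
proof -
  have "is_subspace3 {x. dot y x = 0}"
    by (simp add: is_subspace3_def dot_add_right dot_smult_right)
  moreover have "card {x. dot y x = 0} = 3 ^ 3"
    using card_dot_kernel[OF assms] by simp
  ultimately show ?thesis
    unfolding is_hyperplane_def by blast
qed

lemma cohyperplanar_if_has_annihilator:
  assumes "has_annihilator V"
  shows "cohyperplanar (\<Union>v\<in>V. {a + v, a - v})"
proof -
  obtain y where y: "y \<noteq> 0" "\<And>v. v \<in> V \<Longrightarrow> dot y v = 0"
    using assms unfolding has_annihilator_def by blast
  have "a - v = a + (- v)" for v :: pt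
    by simp
  then have "(\<Union>v\<in>V. {a + v, a - v}) \<subseteq> (\<lambda>v. a + v) ` {x. dot y x = 0}"
    using y(2) by (auto simp: dot_minus_right)
  then show ?thesis
    using hyperplane_dot_kernel[OF y(1)] unfolding cohyperplanar_def by blast
qed

lemma line_card_sum:
  assumes "is_line S"
  shows "card S = 3" and "\<Sum>S = 0"
  using assms unfolding is_line_def by (auto simp: add.assoc)

lemma a_line_pair:
  assumes "is_a_line a P"
  shows "\<exists>v. P = {a + v, a - v}"
proof -
  obtain b c where P: "P = {b, c}" "b \<noteq> c" and line: "is_line {a, b, c}"
    using assms unfolding is_a_line_def by blast
  have "a \<noteq> b" "a \<noteq> c"
    using line_card_sum(1)[OF line] P(2) by (auto simp: card_insert_if)
  then have "a + b + c = 0"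
    using line_card_sum(2)[OF line] P(2) by (simp add: add.assoc)
  have "a - (b - a) = (a + a + a) - (a + b + c) + c"
    by (simp add: algebra_simps)
  also have "\<dots> = c"
    using \<open>a + b + c = 0\<close> vec3_add_self_twice[of a] by simp
  finally have "a - (b - a) = c" .
  then show ?thesis
    using P(1) by (intro exI[of _ "b - a"]) simp
qed

definition column_matrix :: "('n \<Rightarrow> 'a^'m) \<Rightarrow> 'a^'n^'m" where
  "column_matrix u = (\<chi> i j. u j $ i)"

lemma column_matrix_mult:
  fixes u :: "'n::finite \<Rightarrow> 'a::comm_semiring_1^'m"
  shows "column_matrix u *v x = (\<Sum>j\<in>UNIV. x $ j *s u j)"
  by (simp add: column_matrix_def matrix_vector_mult_def vec_eq_iff mult.commute)

lemma column_matrix_mult_axis: "column_matrix u *v axis j 1 = u j"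
proof -
  have "(\<Sum>k\<in>UNIV. u k $ i * axis j 1 $ k) = (\<Sum>k\<in>UNIV. if k = j then u j $ i else 0)" for i
    by (rule sum.cong) (auto simp: axis_def)
  then show ?thesis
    by (simp add: column_matrix_def matrix_vector_mult_def vec_eq_iff)
qed

lemma matrix_mult_column_matrix: "A ** column_matrix u = column_matrix (\<lambda>j. A *v u j)"
  by (simp add: column_matrix_def matrix_matrix_mult_def matrix_vector_mult_def vec_eq_iff)

lemma column_matrix_axis: "column_matrix (\<lambda>j. axis j 1) = mat 1"
  by (simp add: column_matrix_def mat_def axis_def vec_eq_iff)

lemma dot_sum_single:
  assumes "\<And>j. j \<noteq> k \<Longrightarrow> dot y (u j) = 0"
  shows "dot y (\<Sum>j\<in>UNIV. x $ j *s u j) = x $ k * dot y (u k)"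
proof -
  have "dot y (\<Sum>j\<in>UNIV. x $ j *s u j) = (\<Sum>j\<in>UNIV. x $ j * dot y (u j))"
    by (simp add: dot_sum_right dot_smult_right)
  also have "\<dots> = x $ k * dot y (u k) + (\<Sum>j\<in>UNIV - {k}. x $ j * dot y (u j))"
    by (rule sum.remove) simp_all
  also have "(\<Sum>j\<in>UNIV - {k}. x $ j * dot y (u j)) = 0"
    using assms by (intro sum.neutral) simp
  finally show ?thesis
    by simp
qed

lemma has_annihilator_all_but_one:
  fixes u :: "'n \<Rightarrow> 'a::{comm_ring_1,finite}^'n"
  shows "has_annihilator (u ` (UNIV - {k}))"
  by (rule has_annihilator_if_card_less, rule le_less_trans[OF card_image_le card_Diff1_less]) simp_all

lemma combination_eq_0_imp_coeffs_eq_0: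
  fixes u :: "'n \<Rightarrow> 3^'n"
  assumes "\<not> has_annihilator (range u)" and "(\<Sum>j\<in>UNIV. x $ j *s u j) = 0"
  shows "x = 0"
proof (rule ccontr)
  assume "x \<noteq> 0"
  then obtain k where "x $ k \<noteq> 0"
    by (auto simp: vec_eq_iff)
  obtain y where y: "y \<noteq> 0" "\<And>j. j \<noteq> k \<Longrightarrow> dot y (u j) = 0"
    using has_annihilator_all_but_one[of u k] unfolding has_annihilator_def by blast
  have "x $ k * dot y (u k) = 0"
    using dot_sum_single[of k y u x, OF y(2)] assms(2) by simp
  then have "dot y (u k) = 0"
    using \<open>x $ k \<noteq> 0\<close> num3_mult_eq_0_iff by blast
  then have "has_annihilator (range u)"
    using y unfolding has_annihilator_def by (metis rangeE)
  with assms(1) show False ..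
qed

lemma combination_coeff_nonzero:
  fixes u :: "'n \<Rightarrow> 3^'n"
  assumes "u0 = (\<Sum>j\<in>UNIV. w $ j *s u j)"
    and "\<not> has_annihilator (insert u0 (u ` (UNIV - {k})))"
  shows "w $ k \<noteq> 0"
proof
  assume "w $ k = 0"
  obtain y where y: "y \<noteq> 0" "\<And>j. j \<noteq> k \<Longrightarrow> dot y (u j) = 0"
    using has_annihilator_all_but_one[of u k] unfolding has_annihilator_def by blast
  have "dot y u0 = 0"
    using dot_sum_single[of k y u w, OF y(2)] assms(1) \<open>w $ k = 0\<close> by simp
  then have "has_annihilator (insert u0 (u ` (UNIV - {k})))"
    using y unfolding has_annihilator_def by blast
  with assms(2) show False ..
qed

lemma invertible_if_trivial_kernel:
  fixes A :: "'a::{comm_ring_1,finite}^'n^'n"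
  assumes "\<And>x. A *v x = 0 \<Longrightarrow> x = 0"
  shows "invertible A"
proof -
  have inj: "inj ((*v) A)"
    by (rule injI) (metis assms eq_iff_diff_eq_0 matrix_vector_mult_diff_distrib)
  then have "surj ((*v) A)"
    by (simp add: finite_UNIV_inj_surj)
  then obtain g where g: "\<And>z. A *v g z = z"
    by (metis surj_f_inv_f)
  define B where "B = column_matrix (\<lambda>j. g (axis j 1))"
  have AB: "A ** B = mat 1"
    by (simp add: B_def matrix_mult_column_matrix g column_matrix_axis)
  have "A *v ((B ** A) *v x) = A *v x" for x
    by (simp add: matrix_vector_mul_assoc matrix_mul_assoc AB)
  then have "B ** A = mat 1"
    using inj by (simp add: matrix_eq inj_eq)
  with AB show ?thesis
    unfolding invertible_def by blast
qed

lemma standard_frame: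
  fixes u :: "'n \<Rightarrow> 3^'n"
  assumes indep: "\<not> has_annihilator (range u)"
    and general: "\<And>k. \<not> has_annihilator (insert u0 (u ` (UNIV - {k})))"
  obtains A :: "3^'n^'n" and w :: "3^'n"
  where "invertible A" "\<And>j. w $ j \<noteq> 0" "\<And>j. A *v axis j 1 = w $ j *s u j"
    and "A *v (\<chi> i. 1) = u0"
proof -
  define M where "M = column_matrix u"
  have "invertible M"
    by (rule invertible_if_trivial_kernel)
      (use combination_eq_0_imp_coeffs_eq_0[OF indep] in \<open>simp add: M_def column_matrix_mult\<close>)
  then obtain M' where "M ** M' = mat 1"
    unfolding invertible_def by blast
  define w where "w = M' *v u0"
  have u0: "u0 = (\<Sum>j\<in>UNIV. w $ j *s u j)"
    using \<open>M ** M' = mat 1\<close>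
    by (simp add: w_def matrix_vector_mul_assoc M_def[symmetric] column_matrix_mult[symmetric])
  have w: "w $ j \<noteq> 0" for j
    using combination_coeff_nonzero[OF u0 general] .
  define A where "A = column_matrix (\<lambda>j. w $ j *s u j)"
  have A: "A *v x = (\<Sum>j\<in>UNIV. (\<chi> j. x $ j * w $ j) $ j *s u j)" for x
    by (simp add: A_def column_matrix_mult)
  have "invertible A"
  proof (rule invertible_if_trivial_kernel)
    fix x assume "A *v x = 0"
    then have "(\<chi> j. x $ j * w $ j) = 0"
      unfolding A by (rule combination_eq_0_imp_coeffs_eq_0[OF indep])
    then show "x = 0"
      using w by (simp add: vec_eq_iff num3_mult_eq_0_iff)
  qed
  moreover have "A *v axis j 1 = w $ j *s u j" for j
    by (simp add: A_def column_matrix_mult_axis)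
  moreover have "A *v (\<chi> i. 1) = u0"
    by (simp add: A u0)
  ultimately show ?thesis
    using that w by blast
qed

definition standard_demicap :: "(3^'n) set" where
  "standard_demicap = (\<Union>v\<in>insert (\<chi> i. 1) (range (\<lambda>j. axis j 1)). {v, - v})"

lemma affine_image_standard_demicap:
  fixes u :: "'n \<Rightarrow> 3^'n"
  assumes "\<not> has_annihilator (range u)"
    and "\<And>k. \<not> has_annihilator (insert u0 (u ` (UNIV - {k})))"
  shows "\<exists>A :: 3^'n^'n. invertible A \<and>
    (\<lambda>x. A *v x + a) ` standard_demicap = (\<Union>v\<in>insert u0 (range u). {a + v, a - v})"
proof -
  obtain A :: "3^'n^'n" and w where A: "invertible A" "\<And>j. w $ j \<noteq> 0"
    "\<And>j. A *v axis j 1 = w $ j *s u j" "A *v (\<chi> i. 1) = u0"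
    using standard_frame[OF assms] by blast
  have minus: "A *v (- v) = - (A *v v)" for v
    using matrix_vector_mult_diff_distrib[of A 0 v] by simp
  have "(\<lambda>x. A *v x + a) ` {v, - v} = {a + A *v v, a - A *v v}" for v
    by (auto simp: minus algebra_simps)
  then have "(\<lambda>x. A *v x + a) ` standard_demicap
      = (\<Union>v\<in>insert (\<chi> i. 1) (range (\<lambda>j. axis j 1)). {a + A *v v, a - A *v v})"
    unfolding standard_demicap_def image_UN by simp
  also have "\<dots> = (\<Union>v\<in>insert u0 (range u). {a + v, a - v})"
    by (simp add: A(3,4) pair_smult_num3[OF A(2)])
  finally show ?thesis
    using A(1) by blast
qed

lemma demicap_anchor_frame:
  assumes "is_demicap_anchor a D"
  obtains u :: "4 \<Rightarrow> pt" and u0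
  where "D = (\<Union>v\<in>insert u0 (range u). {a + v, a - v})"
    and "\<not> has_annihilator (range u)"
    and "\<And>k. \<not> has_annihilator (insert u0 (u ` (UNIV - {k})))"
proof -
  obtain L where L: "card L = 5" "\<And>P. P \<in> L \<Longrightarrow> is_a_line a P" "D = \<Union>L"
    and general: "\<And>L'. L' \<subseteq> L \<Longrightarrow> card L' = 4 \<Longrightarrow> \<not> cohyperplanar (\<Union>L')"
    using assms unfolding is_demicap_anchor_def by blast
  obtain dir where dir: "\<And>P. P \<in> L \<Longrightarrow> P = {a + dir P, a - dir P}"
    using a_line_pair L(2) by metis
  have pairs: "\<Union>L' = (\<Union>v\<in>dir ` L'. {a + v, a - v})" if "L' \<subseteq> L" for L'
    using dir that by auto
  have no_annihilator: "\<not> has_annihilator (dir ` L')" if "L' \<subseteq> L" "card L' = 4" for L'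
  proof
    assume "has_annihilator (dir ` L')"
    then have "cohyperplanar (\<Union>L')"
      unfolding pairs[OF that(1)] by (rule cohyperplanar_if_has_annihilator)
    with general[OF that] show False ..
  qed
  have "finite L"
    using L(1) by (simp add: card_ge_0_finite)
  obtain P0 where "P0 \<in> L"
    using L(1) by fastforce
  then have "card (UNIV :: 4 set) = card (L - {P0})"
    using L(1) by simp
  then obtain f :: "4 \<Rightarrow> pt set" where f: "bij_betw f UNIV (L - {P0})"
    using finite_same_card_bij[OF finite_class.finite_UNIV finite_Diff[OF \<open>finite L\<close>]] by blast
  then have L_eq: "L = insert P0 (range f)" and "inj f"
    using \<open>P0 \<in> L\<close> by (auto simp: bij_betw_def)
  show ?thesis
  proof
    show "D = (\<Union>v\<in>insert (dir P0) (range (dir \<circ> f)). {a + v, a - v})"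
      using L(3) pairs[of L] L_eq by (simp add: image_comp)
    have "\<not> has_annihilator (dir ` range f)"
      by (rule no_annihilator) (use L_eq \<open>inj f\<close> in \<open>auto simp: card_image\<close>)
    then show "\<not> has_annihilator (range (dir \<circ> f))"
      by (simp add: image_comp)
  next
    fix k
    have "P0 \<notin> f ` (UNIV - {k})" "card (f ` (UNIV - {k})) = 3"
      using f \<open>inj f\<close> by (auto simp: bij_betw_def card_image inj_on_subset card_Diff_singleton)
    then have "\<not> has_annihilator (dir ` insert P0 (f ` (UNIV - {k})))"
      by (intro no_annihilator) (use L_eq in auto)
    then show "\<not> has_annihilator (insert (dir P0) ((dir \<circ> f) ` (UNIV - {k})))"
      by (simp add: image_comp)
  qed
qed

lemma demicap_affine_image_standard:
  assumes "is_demicap D"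
  shows "\<exists>(A::3^4^4) b. invertible A \<and> (\<lambda>v. A *v v + b) ` standard_demicap = D"
proof -
  obtain a where anchor: "is_demicap_anchor a D"
    using assms unfolding is_demicap_def by blast
  obtain u :: "4 \<Rightarrow> pt" and u0 where D: "D = (\<Union>v\<in>insert u0 (range u). {a + v, a - v})"
    and frame: "\<not> has_annihilator (range u)" "\<And>k. \<not> has_annihilator (insert u0 (u ` (UNIV - {k})))"
    using demicap_anchor_frame[OF anchor] by blast
  show ?thesis
    using affine_image_standard_demicap[OF frame, of a] unfolding D by blast
qed

lemma affine_equivalent_of_common_preimage:
  fixes A1 A2 :: "'a::comm_ring_1^'n^'n"
  assumes "invertible A1" "(\<lambda>v. A1 *v v + b1) ` S = T1"
    and "invertible A2" "(\<lambda>v. A2 *v v + b2) ` S = T2"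
  shows "\<exists>A b. invertible A \<and> (\<lambda>v. A *v v + b) ` T1 = T2"
proof -
  obtain B1 where B1: "A1 ** B1 = mat 1" "B1 ** A1 = mat 1"
    using assms(1) unfolding invertible_def by blast
  define A where "A = A2 ** B1"
  define b where "b = b2 - A *v b1"
  have "invertible B1"
    using B1 unfolding invertible_def by blast
  then have "invertible A"
    unfolding A_def using assms(3) by (rule invertible_mult[rotated])
  moreover have "B1 *v (A1 *v v) = v" for v
    by (simp add: matrix_vector_mul_assoc B1(2))
  then have "A *v (A1 *v v + b1) + b = A2 *v v + b2" for v
    by (simp add: A_def b_def matrix_vector_right_distrib matrix_vector_mul_assoc[symmetric])
  then have "(\<lambda>v. A *v v + b) ` T1 = T2"
    unfolding assms(2,4)[symmetric] image_image by simp
  ultimately show ?thesis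
    by blast
qed

theorem theorem3p6:
  assumes "is_demicap D1" and "is_demicap D2"
  shows "\<exists>(A::3^4^4) (b::3^4). invertible A \<and> (\<lambda>v. A *v v + b) ` D1 = D2"
proof -
  obtain A1 :: "3^4^4" and b1 where "invertible A1" "(\<lambda>v. A1 *v v + b1) ` standard_demicap = D1"
    using demicap_affine_image_standard[OF assms(1)] by blast
  moreover obtain A2 :: "3^4^4" and b2 where "invertible A2" "(\<lambda>v. A2 *v v + b2) ` standard_demicap = D2"
    using demicap_affine_image_standard[OF assms(2)] by blast
  ultimately show ?thesis
    by (rule affine_equivalent_of_common_preimage)
qed

end
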